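(* Let $\mathcal T_\theta$, $d\beta$, $f_{\mathrm{push}}:\mathcal T_\theta\to\mathcal A(f)$, $\mathcal T(f)=\overline{\operatorname{range} f_{\mathrm{push}}}$ and $\operatorname{Bnd}(\theta)$ be as in the context. Suppose $d\beta(\dot\phi)=0$ for every $\dot\phi\in\mathcal T_\theta$ with $f_{\mathrm{push}}\dot\phi=0$, so that the score differential, i.e. the linear functional $\Delta\beta:\operatorname{range} f_{\mathrm{push}}\to\mathbb R$ with $$\Delta\beta(f_{\mathrm{push}}\dot\phi)=d\beta(\dot\phi)\quad\forall\dot\phi\in\mathcal T_\theta,$$ is well defined. Then $\operatorname{Bnd}(\theta)=\|\Delta\beta\|^2<\infty$ (operator norm with respect to $\|\cdot\|_f$) if and only if $\Delta\beta$ has a Riesz representation in $\mathcal T(f)$, i.e. there exists $\nabla\beta\in\mathcal T(f)$ such that $$d\beta(\dot\phi)=\Delta\beta(f_{\mathrm{push}}\dot\phi)=\langle\nabla\beta,f_{\mathrm{push}}\dot\phi\rangle_f\quad\forall\dot\phi\in\mathcal T_\theta .$$ In that case $$\operatorname{Bnd}(\theta)=\|\nabla\beta\|_f^2 .$$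
   Context: Setting. Fix a parameter value $\theta$ in a parameter space. $\mathcal T_\theta$ is a real vector space (the tangent vectors $\dot\phi$ at $\theta$ of parametric submodels, i.e. curves $\phi$ through $\theta$), of arbitrary dimension; only its vector-space structure matters. $d\beta:\mathcal T_\theta\to\mathbb R$ is a linear functional (the differential of a scalar parameter of interest $\beta$). $\mathcal V$ is a real vector space with a semi-inner product $\langle\cdot,\cdot\rangle_f$ (symmetric, bilinear, positive-semidefinite) and seminorm $\|\cdot\|_f$; $\operatorname{score}:\mathcal T_\theta\to\mathcal V$ is a linear map; the information is $\operatorname{info}_\theta(\dot\phi,\dot\chi)=\langle\operatorname{score}(\dot\phi),\operatorname{score}(\dot\chi)\rangle_f$. Let $\mathcal N(f)=\{A\in\mathcal V:\|A\|_f=0\}$, and let $\mathcal A(f)$ be the Hilbert-space completion of the inner-product space $\mathcal V/\mathcal N(f)$. The pushforward is the linear map $f_{\mathrm{push}}:\mathcal T_\theta\to\mathcal A(f)$, $f_{\mathrm{push}}\dot\phi=\operatorname{score}(\dot\phi)+\mathcal N(f)$. The score tangent space is $\mathcal T(f)=\overline{\operatorname{range} f_{\mathrm{push}}}\subseteq\mathcal A(f)$ (closure in $\mathcal A(f)$). Efficiency bound. $\operatorname{Bnd}(\theta)=\sup_{\dot\phi\in\mathcal T_\theta:\,f_{\mathrm{push}}\dot\phi\neq0}\dfrac{[d\beta(\dot\phi)]^2}{\|f_{\mathrm{push}}\dot\phi\|_f^2}\in[0,\infty]$ (the supremum of the empty set being $0$) when $d\beta(\dot\phi)=0$ for all $\dot\phi$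 with $f_{\mathrm{push}}\dot\phi=0$; otherwise $\operatorname{Bnd}(\theta)=\infty$. *)

theory Defs
  imports "HOL-Analysis.Analysis"
begin

section \<open>Semi-inner-product spaces\<close>

class semi_inner_space = real_vector +
  fixes sinner :: "'a \<Rightarrow> 'a \<Rightarrow> real"
  assumes sinner_commute: "sinner x y = sinner y x"
    and sinner_add_left: "sinner (x + y) z = sinner x z + sinner y z"
    and sinner_scaleR_left: "sinner (r *\<^sub>R x) y = r * sinner x y"
    and sinner_nonneg: "0 \<le> sinner x x"

definition seminorm :: "'a::semi_inner_space \<Rightarrow> real" where
  "seminorm x = sqrt (sinner x x)"

definition null_vectors :: "'a::semi_inner_space set" where
  "null_vectors = {x. seminorm x = 0}"

lemma null_vectors_iff: "x \<in> null_vectors \<longleftrightarrow> sinner x x = 0"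
  by (simp add: null_vectors_def seminorm_def)

lemma sinner_add_right: "sinner z (x + y) = sinner z x + sinner z (y :: 'a::semi_inner_space)"
  by (metis sinner_add_left sinner_commute)

lemma sinner_scaleR_right: "sinner y (r *\<^sub>R x) = r * sinner y (x :: 'a::semi_inner_space)"
  by (metis sinner_scaleR_left sinner_commute)

lemma sinner_minus_left: "sinner (- x) y = - sinner x (y :: 'a::semi_inner_space)"
  using sinner_scaleR_left[of "-1" x y] by simp

lemma sinner_diff_left: "sinner (x - y) z = sinner x z - sinner y (z :: 'a::semi_inner_space)"
  using sinner_add_left[of x "- y" z] by (simp add: sinner_minus_left)

lemma sinner_null_left:
  fixes x y :: "'a::semi_inner_space"
  assumes "x \<in> null_vectors"
  shows "sinner x y = 0"
proof (rule ccontr)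
  assume ne: "sinner x y \<noteq> 0"
  have x0: "sinner x x = 0"
    using assms by (simp add: null_vectors_iff)
  define t where "t = - (sinner y y + 1) / (2 * sinner x y)"
  have "0 \<le> sinner (t *\<^sub>R x + y) (t *\<^sub>R x + y)"
    by (rule sinner_nonneg)
  also have "\<dots> = 2 * t * sinner x y + sinner y y"
    by (simp add: sinner_add_left sinner_add_right sinner_scaleR_left sinner_scaleR_right
        x0 sinner_commute[of y x])
  also have "\<dots> = - 1"
    using ne by (simp add: t_def field_simps)
  finally show False by simp
qed

lemma subspace_null_vectors: "subspace null_vectors"
  unfolding subspace_def
proof (intro conjI ballI allI)
  show "0 \<in> null_vectors"
    using sinner_scaleR_left[of 0 0] by (simp add: null_vectors_iff)
next
  fix x y :: 'a assume "x \<in> null_vectors" "y \<in> null_vectors"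
  then show "x + y \<in> null_vectors"
    by (simp add: null_vectors_iff[of "x + y"] sinner_add_left sinner_null_left)
next
  fix c and x :: 'a assume "x \<in> null_vectors"
  then show "c *\<^sub>R x \<in> null_vectors"
    by (simp add: null_vectors_iff[of "c *\<^sub>R x"] sinner_scaleR_left sinner_null_left)
qed

section \<open>The quotient by the null vectors\<close>

definition null_rel :: "'a::semi_inner_space \<Rightarrow> 'a \<Rightarrow> bool" where
  "null_rel x y \<longleftrightarrow> x - y \<in> null_vectors"

lemma equivp_null_rel: "equivp (null_rel :: 'a::semi_inner_space \<Rightarrow> 'a \<Rightarrow> bool)"
proof (rule equivpI)
  show "reflp (null_rel :: 'a \<Rightarrow> 'a \<Rightarrow> bool)"
    by (simp add: reflp_def null_rel_def subspace_0 subspace_null_vectors)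
  show "symp (null_rel :: 'a \<Rightarrow> 'a \<Rightarrow> bool)"
    unfolding symp_def null_rel_def
    by (metis minus_diff_eq subspace_neg subspace_null_vectors)
  show "transp (null_rel :: 'a \<Rightarrow> 'a \<Rightarrow> bool)"
  proof (rule transpI)
    fix x y z :: 'a assume "null_rel x y" "null_rel y z"
    then have "(x - y) + (y - z) \<in> null_vectors"
      unfolding null_rel_def by (rule subspace_add[OF subspace_null_vectors])
    then show "null_rel x z" by (simp add: null_rel_def)
  qed
qed

quotient_type (overloaded) 'a null_quotient = "'a::semi_inner_space" / null_rel
  morphisms rep_null_quotient null_coset
  by (rule equivp_null_rel)

lemma sinner_null_rel_cong:
  assumes "null_rel x x'" "null_rel y y'"
  shows "sinner x y = sinner x' y'"
proof -
  have "sinner (x - x') y = 0" "sinner (y - y') x' = 0"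
    using assms by (auto simp: null_rel_def sinner_null_left)
  then show ?thesis
    by (simp add: sinner_diff_left sinner_commute[of y x'] sinner_commute[of y' x'])
qed

instantiation null_quotient :: (semi_inner_space) real_inner
begin

lift_definition zero_null_quotient :: "'a null_quotient" is 0 .

lift_definition plus_null_quotient :: "'a null_quotient \<Rightarrow> 'a null_quotient \<Rightarrow> 'a null_quotient"
  is "(+)"
proof -
  fix x x' y y' :: 'a assume "null_rel x x'" "null_rel y y'"
  then have "(x - x') + (y - y') \<in> null_vectors"
    unfolding null_rel_def by (rule subspace_add[OF subspace_null_vectors])
  then show "null_rel (x + y) (x' + y')" by (simp add: null_rel_def algebra_simps)
qed

lift_definition uminus_null_quotient :: "'a null_quotient \<Rightarrow> 'a null_quotient"
  is uminus
  unfolding null_rel_def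
  by (metis minus_diff_minus subspace_neg subspace_null_vectors)

lift_definition minus_null_quotient :: "'a null_quotient \<Rightarrow> 'a null_quotient \<Rightarrow> 'a null_quotient"
  is "(-)"
proof -
  fix x x' y y' :: 'a assume "null_rel x x'" "null_rel y y'"
  then have "(x - x') - (y - y') \<in> null_vectors"
    unfolding null_rel_def by (rule subspace_diff[OF subspace_null_vectors])
  then show "null_rel (x - y) (x' - y')" by (simp add: null_rel_def algebra_simps)
qed

lift_definition scaleR_null_quotient :: "real \<Rightarrow> 'a null_quotient \<Rightarrow> 'a null_quotient"
  is "scaleR"
  unfolding null_rel_def
  by (metis scaleR_diff_right subspace_scale subspace_null_vectors)

lift_definition inner_null_quotient :: "'a null_quotient \<Rightarrow> 'a null_quotient \<Rightarrow> real"
  is sinner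
  by (rule sinner_null_rel_cong)

definition norm_null_quotient :: "'a null_quotient \<Rightarrow> real" where
  "norm_null_quotient x = sqrt (inner x x)"

definition sgn_null_quotient :: "'a null_quotient \<Rightarrow> 'a null_quotient" where
  "sgn_null_quotient x = scaleR (inverse (norm x)) x"

definition dist_null_quotient :: "'a null_quotient \<Rightarrow> 'a null_quotient \<Rightarrow> real" where
  "dist_null_quotient x y = norm (x - y)"

definition uniformity_null_quotient :: "('a null_quotient \<times> 'a null_quotient) filter" where
  "uniformity_null_quotient = (INF e\<in>{0 <..}. principal {(x, y). dist x y < e})"

definition open_null_quotient :: "'a null_quotient set \<Rightarrow> bool" where
  "open_null_quotient S = (\<forall>x\<in>S. \<forall>\<^sub>F (x', y) in uniformity. x' = x \<longrightarrow> y \<in> S)"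

instance
proof
  have refl: "null_rel x x" for x :: 'a
    by (simp add: null_rel_def subspace_0 subspace_null_vectors)
  fix x y z :: "'a null_quotient" and a b r :: real
  show "x + y + z = x + (y + z)" by transfer (simp add: refl add.assoc)
  show "x + y = y + x" by transfer (simp add: refl add.commute)
  show "0 + x = x" by transfer (simp add: refl)
  show "- x + x = 0" by transfer (simp add: refl)
  show "x - y = x + - y" by transfer (simp add: refl)
  show "a *\<^sub>R (x + y) = a *\<^sub>R x + a *\<^sub>R y" by transfer (simp add: refl scaleR_add_right)
  show "(a + b) *\<^sub>R x = a *\<^sub>R x + b *\<^sub>R x" by transfer (simp add: refl scaleR_add_left)
  show "a *\<^sub>R b *\<^sub>R x = (a * b) *\<^sub>R x" by transfer (simp add: refl)
  show "1 *\<^sub>R x = x" by transfer (simp add: refl)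
  show "inner x y = inner y x" by transfer (rule sinner_commute)
  show "inner (x + y) z = inner x z + inner y z" by transfer (rule sinner_add_left)
  show "inner (r *\<^sub>R x) y = r * inner x y" by transfer (rule sinner_scaleR_left)
  show "0 \<le> inner x x" by transfer (rule sinner_nonneg)
  show "inner x x = 0 \<longleftrightarrow> x = 0" by transfer (simp add: null_rel_def null_vectors_iff)
qed (simp_all add: norm_null_quotient_def sgn_null_quotient_def dist_null_quotient_def
    uniformity_null_quotient_def open_null_quotient_def)

end

lemma linear_null_coset: "linear null_coset"
  by (rule linearI; transfer) (simp_all add: null_rel_def subspace_0 subspace_null_vectors)

lemma inner_null_coset: "null_coset x \<bullet> null_coset y = sinner x y"
  by transfer simp

lemma norm_null_coset: "norm (null_coset x) = seminorm x"
  by (simp add: norm_eq_sqrt_inner inner_null_coset seminorm_def)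

section \<open>The Hilbert-space completion of an inner product space\<close>

text \<open>
  The completion is the closure of the isometric copy of the space in its Banach dual under
  the embedding that sends \<open>x\<close> to the functional \<open>y \<mapsto> x \<bullet> y\<close>; the norm is the dual norm and the
  inner product comes from it by polarization.  The facts \<open>inner_to_completion\<close>,
  \<open>closure_range_to_completion\<close> and the \<^class>\<open>complete_space\<close> instance show that this is a complete
  inner product space containing the original one isometrically and densely, which determines
  it up to isometric isomorphism.
\<close>

lemma norm_blinfun_inner_right: "norm (blinfun_inner_right x) = norm x"
proof (rule norm_blinfun_eqI)
  show "norm x \<le> norm (blinfun_apply (blinfun_inner_right x) x) / norm x"
    by (cases "x = 0") (simp_all add: dot_square_norm power2_eq_square)
  show "norm (blinfun_apply (blinfun_inner_right x) y) \<le> norm x * norm y" for y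
    using Cauchy_Schwarz_ineq2[of x y] by simp
qed simp

definition dual_copy_closure :: "('a::real_inner \<Rightarrow>\<^sub>L real) set" where
  "dual_copy_closure = closure (range blinfun_inner_right)"

lemma dual_copy_closure_iff:
  "f \<in> dual_copy_closure \<longleftrightarrow> (\<exists>a. (\<lambda>n. blinfun_inner_right (a n)) \<longlonglongrightarrow> f)"
proof
  assume "f \<in> dual_copy_closure"
  then obtain X where X: "\<forall>n. X n \<in> range blinfun_inner_right" "X \<longlonglongrightarrow> f"
    unfolding dual_copy_closure_def closure_sequential by blast
  from X(1) have "\<forall>n. \<exists>b. X n = blinfun_inner_right b" by blast
  from choice[OF this] obtain a where "\<forall>n. X n = blinfun_inner_right (a n)" by blast
  then have "X = (\<lambda>n. blinfun_inner_right (a n))" by (simp add: fun_eq_iff)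
  then have "(\<lambda>n. blinfun_inner_right (a n)) \<longlonglongrightarrow> f" using X(2) by (simp only:)
  then show "\<exists>a. (\<lambda>n. blinfun_inner_right (a n)) \<longlonglongrightarrow> f" by (rule exI[of _ a])
next
  assume "\<exists>a. (\<lambda>n. blinfun_inner_right (a n)) \<longlonglongrightarrow> f"
  then obtain a where "(\<lambda>n. blinfun_inner_right (a n)) \<longlonglongrightarrow> f" by blast
  then show "f \<in> dual_copy_closure"
    unfolding dual_copy_closure_def closure_sequential
    by (intro exI[of _ "\<lambda>n. blinfun_inner_right (a n)"]) simp
qed

lemma linear_blinfun_inner_right: "linear blinfun_inner_right"
  by (rule bounded_linear.linear[OF bounded_linear_blinfun_inner_right])

lemma subspace_dual_copy_closure: "subspace (dual_copy_closure :: ('a::real_inner \<Rightarrow>\<^sub>L real) set)"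
  unfolding subspace_def
proof (intro conjI ballI allI)
  show "0 \<in> (dual_copy_closure :: ('a \<Rightarrow>\<^sub>L real) set)"
    unfolding dual_copy_closure_def
    by (rule subsetD[OF closure_subset], rule range_eqI[of _ _ 0])
      (simp add: linear_0[OF linear_blinfun_inner_right])
next
  fix f g :: "'a \<Rightarrow>\<^sub>L real" assume "f \<in> dual_copy_closure" "g \<in> dual_copy_closure"
  then obtain a b where "(\<lambda>n. blinfun_inner_right (a n)) \<longlonglongrightarrow> f"
    "(\<lambda>n. blinfun_inner_right (b n)) \<longlonglongrightarrow> g"
    unfolding dual_copy_closure_iff by blast
  then have "(\<lambda>n. blinfun_inner_right (a n + b n)) \<longlonglongrightarrow> f + g"
    unfolding linear_add[OF linear_blinfun_inner_right] by (rule tendsto_add)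
  then show "f + g \<in> dual_copy_closure"
    unfolding dual_copy_closure_iff by (intro exI[of _ "\<lambda>n. a n + b n"])
next
  fix c and f :: "'a \<Rightarrow>\<^sub>L real" assume "f \<in> dual_copy_closure"
  then obtain a where "(\<lambda>n. blinfun_inner_right (a n)) \<longlonglongrightarrow> f"
    unfolding dual_copy_closure_iff by blast
  then have "(\<lambda>n. blinfun_inner_right (c *\<^sub>R a n)) \<longlonglongrightarrow> c *\<^sub>R f"
    unfolding linear_scale[OF linear_blinfun_inner_right] by (intro tendsto_intros)
  then show "c *\<^sub>R f \<in> dual_copy_closure"
    unfolding dual_copy_closure_iff by (intro exI[of _ "\<lambda>n. c *\<^sub>R a n"])
qed

typedef (overloaded) 'a hilbert_completion = "dual_copy_closure :: ('a::real_inner \<Rightarrow>\<^sub>L real) set"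
  using subspace_0[OF subspace_dual_copy_closure] by blast

setup_lifting type_definition_hilbert_completion

instantiation hilbert_completion :: (real_inner) real_normed_vector
begin

lift_definition zero_hilbert_completion :: "'a hilbert_completion" is 0
  by (rule subspace_0[OF subspace_dual_copy_closure])

lift_definition plus_hilbert_completion ::
  "'a hilbert_completion \<Rightarrow> 'a hilbert_completion \<Rightarrow> 'a hilbert_completion" is "(+)"
  by (rule subspace_add[OF subspace_dual_copy_closure])

lift_definition uminus_hilbert_completion ::
  "'a hilbert_completion \<Rightarrow> 'a hilbert_completion" is uminus
  by (rule subspace_neg[OF subspace_dual_copy_closure])

lift_definition minus_hilbert_completion ::
  "'a hilbert_completion \<Rightarrow> 'a hilbert_completion \<Rightarrow> 'a hilbert_completion" is "(-)"
  by (rule subspace_diff[OF subspace_dual_copy_closure])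

lift_definition scaleR_hilbert_completion ::
  "real \<Rightarrow> 'a hilbert_completion \<Rightarrow> 'a hilbert_completion" is scaleR
  by (rule subspace_scale[OF subspace_dual_copy_closure])

lift_definition norm_hilbert_completion :: "'a hilbert_completion \<Rightarrow> real" is norm .

definition sgn_hilbert_completion :: "'a hilbert_completion \<Rightarrow> 'a hilbert_completion" where
  "sgn_hilbert_completion x = scaleR (inverse (norm x)) x"

definition dist_hilbert_completion ::
  "'a hilbert_completion \<Rightarrow> 'a hilbert_completion \<Rightarrow> real" where
  "dist_hilbert_completion x y = norm (x - y)"

definition uniformity_hilbert_completion ::
  "('a hilbert_completion \<times> 'a hilbert_completion) filter" where
  "uniformity_hilbert_completion = (INF e\<in>{0 <..}. principal {(x, y). dist x y < e})"

definition open_hilbert_completion :: "'a hilbert_completion set \<Rightarrow> bool" where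
  "open_hilbert_completion S = (\<forall>x\<in>S. \<forall>\<^sub>F (x', y) in uniformity. x' = x \<longrightarrow> y \<in> S)"

instance
proof
  fix x y z :: "'a hilbert_completion" and a b :: real
  show "x + y + z = x + (y + z)" by transfer (simp add: add.assoc)
  show "x + y = y + x" by transfer (simp add: add.commute)
  show "0 + x = x" by transfer simp
  show "- x + x = 0" by transfer simp
  show "x - y = x + - y" by transfer simp
  show "a *\<^sub>R (x + y) = a *\<^sub>R x + a *\<^sub>R y" by transfer (rule scaleR_add_right)
  show "(a + b) *\<^sub>R x = a *\<^sub>R x + b *\<^sub>R x" by transfer (rule scaleR_add_left)
  show "a *\<^sub>R b *\<^sub>R x = (a * b) *\<^sub>R x" by transfer simp
  show "1 *\<^sub>R x = x" by transfer simp
  show "norm x = 0 \<longleftrightarrow> x = 0" by transfer simp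
  show "norm (x + y) \<le> norm x + norm y" by transfer (rule norm_triangle_ineq)
  show "norm (a *\<^sub>R x) = \<bar>a\<bar> * norm x" by transfer simp
qed (simp_all add: sgn_hilbert_completion_def dist_hilbert_completion_def
    uniformity_hilbert_completion_def open_hilbert_completion_def)

end

lift_definition to_completion :: "'a::real_inner \<Rightarrow> 'a hilbert_completion" is blinfun_inner_right
  unfolding dual_copy_closure_def by (rule subsetD[OF closure_subset]) simp

lemma norm_to_completion: "norm (to_completion x) = norm x"
  by transfer (rule norm_blinfun_inner_right)

lemma linear_to_completion: "linear to_completion"
  by (rule linearI; transfer)
    (simp_all add: linear_add[OF linear_blinfun_inner_right]
      linear_scale[OF linear_blinfun_inner_right])

lemma dist_Rep_hilbert_completion:
  "dist (Rep_hilbert_completion x) (Rep_hilbert_completion y) = dist x y"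
  by (simp add: dist_norm norm_hilbert_completion.rep_eq minus_hilbert_completion.rep_eq)

lemma tendsto_Rep_hilbert_completion_iff:
  "((\<lambda>n. Rep_hilbert_completion (X n)) \<longlonglongrightarrow> Rep_hilbert_completion x) \<longleftrightarrow> X \<longlonglongrightarrow> x"
  by (simp add: lim_sequentially dist_Rep_hilbert_completion)

lemma to_completion_approx: "\<exists>a. (\<lambda>n. to_completion (a n)) \<longlonglongrightarrow> x"
proof -
  obtain a where "(\<lambda>n. blinfun_inner_right (a n)) \<longlonglongrightarrow> Rep_hilbert_completion x"
    using Rep_hilbert_completion[of x] unfolding dual_copy_closure_iff by blast
  then have "(\<lambda>n. to_completion (a n)) \<longlonglongrightarrow> x"
    by (subst tendsto_Rep_hilbert_completion_iff[symmetric]) (simp add: to_completion.rep_eq)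
  then show ?thesis by blast
qed

instantiation hilbert_completion :: (real_inner) real_inner
begin

definition inner_hilbert_completion ::
  "'a hilbert_completion \<Rightarrow> 'a hilbert_completion \<Rightarrow> real" where
  "inner_hilbert_completion x y = ((norm (x + y))\<^sup>2 - (norm (x - y))\<^sup>2) / 4"

lemma inner_to_completion_aux: "to_completion a \<bullet> to_completion b = a \<bullet> b"
proof -
  have "to_completion a \<bullet> to_completion b = ((norm (a + b))\<^sup>2 - (norm (a - b))\<^sup>2) / 4"
    unfolding inner_hilbert_completion_def
    by (simp only: linear_add[OF linear_to_completion, symmetric]
        linear_diff[OF linear_to_completion, symmetric] norm_to_completion)
  also have "\<dots> = a \<bullet> b"
    by (simp add: power2_norm_eq_inner inner_add inner_diff inner_commute[of b a])
  finally show ?thesis .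
qed

lemma tendsto_inner_to_completion:
  assumes "(\<lambda>n. to_completion (a n)) \<longlonglongrightarrow> x" "(\<lambda>n. to_completion (b n)) \<longlonglongrightarrow> y"
  shows "(\<lambda>n. a n \<bullet> b n) \<longlonglongrightarrow> x \<bullet> y"
proof -
  have "(\<lambda>n. to_completion (a n) \<bullet> to_completion (b n)) \<longlonglongrightarrow> x \<bullet> y"
    unfolding inner_hilbert_completion_def by (intro tendsto_intros assms) simp
  then show ?thesis by (simp add: inner_to_completion_aux)
qed

instance
proof
  fix x y z :: "'a hilbert_completion" and r :: real
  obtain a b c where lims: "(\<lambda>n. to_completion (a n)) \<longlonglongrightarrow> x"
    "(\<lambda>n. to_completion (b n)) \<longlonglongrightarrow> y" "(\<lambda>n. to_completion (c n)) \<longlonglongrightarrow> z"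
    using to_completion_approx by metis
  have xx: "x \<bullet> x = (norm x)\<^sup>2"
  proof -
    have "x + x = 2 *\<^sub>R x" by (simp add: scaleR_2)
    then show ?thesis by (simp add: inner_hilbert_completion_def power_mult_distrib)
  qed
  show "x \<bullet> y = y \<bullet> x"
    by (simp add: inner_hilbert_completion_def add.commute norm_minus_commute)
  have add: "(\<lambda>n. to_completion (a n + b n)) \<longlonglongrightarrow> x + y"
    unfolding linear_add[OF linear_to_completion] by (intro tendsto_intros lims)
  have "(\<lambda>n. (a n + b n) \<bullet> c n) \<longlonglongrightarrow> x \<bullet> z + y \<bullet> z"
    unfolding inner_add_left by (intro tendsto_add tendsto_inner_to_completion lims)
  with tendsto_inner_to_completion[OF add lims(3)]
  show "(x + y) \<bullet> z = x \<bullet> z + y \<bullet> z" by (rule LIMSEQ_unique)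
  have scale: "(\<lambda>n. to_completion (r *\<^sub>R a n)) \<longlonglongrightarrow> r *\<^sub>R x"
    unfolding linear_scale[OF linear_to_completion] by (intro tendsto_intros lims)
  have "(\<lambda>n. (r *\<^sub>R a n) \<bullet> b n) \<longlonglongrightarrow> r * (x \<bullet> y)"
    unfolding inner_scaleR_left
    by (intro tendsto_mult tendsto_const tendsto_inner_to_completion lims)
  with tendsto_inner_to_completion[OF scale lims(2)]
  show "(r *\<^sub>R x) \<bullet> y = r * (x \<bullet> y)" by (rule LIMSEQ_unique)
  show "0 \<le> x \<bullet> x" "x \<bullet> x = 0 \<longleftrightarrow> x = 0" "norm x = sqrt (x \<bullet> x)"
    by (simp_all add: xx)
qed

end

lemma inner_to_completion: "to_completion a \<bullet> to_completion b = a \<bullet> b"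
  by (rule inner_to_completion_aux)

lemma closure_range_to_completion: "closure (range to_completion) = UNIV"
proof -
  have "x \<in> closure (range to_completion)" for x :: "'a hilbert_completion"
  proof -
    obtain a where "(\<lambda>n. to_completion (a n)) \<longlonglongrightarrow> x"
      using to_completion_approx[of x] by (rule exE)
    then show ?thesis
      unfolding closure_sequential by (intro exI[of _ "\<lambda>n. to_completion (a n)"]) simp
  qed
  then show ?thesis by auto
qed

instance hilbert_completion :: (real_inner) complete_space
proof
  fix X :: "nat \<Rightarrow> 'a hilbert_completion"
  assume "Cauchy X"
  then have "Cauchy (\<lambda>n. Rep_hilbert_completion (X n))"
    by (simp add: Cauchy_def dist_Rep_hilbert_completion)
  then obtain f where f: "(\<lambda>n. Rep_hilbert_completion (X n)) \<longlonglongrightarrow> f"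
    by (auto simp: Cauchy_convergent_iff convergent_def)
  have "f \<in> dual_copy_closure"
    by (rule closed_sequentially[OF _ _ f])
      (use Rep_hilbert_completion in \<open>auto simp: dual_copy_closure_def\<close>)
  then have "f = Rep_hilbert_completion (Abs_hilbert_completion f)"
    by (simp add: Abs_hilbert_completion_inverse)
  with f have "X \<longlonglongrightarrow> Abs_hilbert_completion f"
    using tendsto_Rep_hilbert_completion_iff by metis
  then show "convergent X" by (auto simp: convergent_def)
qed

section \<open>Pushforward, score tangent space, efficiency bound and score differential\<close>

text \<open>The space \<open>\<A>(f)\<close>, for a semi-inner-product space \<open>\<V>\<close> given by the type \<open>'v\<close>.\<close>

type_synonym 'v score_space = "'v null_quotient hilbert_completion"

definition f_push :: "('t \<Rightarrow> 'v::semi_inner_space) \<Rightarrow> 't \<Rightarrow> 'v score_space" where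
  "f_push score \<phi> = to_completion (null_coset (score \<phi>))"

definition score_tangent_space :: "('t \<Rightarrow> 'v::semi_inner_space) \<Rightarrow> 'v score_space set" where
  "score_tangent_space score = closure (range (f_push score))"

text \<open>The supremum of the empty set in \<^typ>\<open>ennreal\<close> is \<open>0\<close>.\<close>

definition Bnd :: "('t \<Rightarrow> real) \<Rightarrow> ('t \<Rightarrow> 'v::semi_inner_space) \<Rightarrow> ennreal" where
  "Bnd d\<beta> score =
    (if \<forall>\<phi>. f_push score \<phi> = 0 \<longrightarrow> d\<beta> \<phi> = 0
     then SUP \<phi>\<in>{\<phi>. f_push score \<phi> \<noteq> 0}. ennreal ((d\<beta> \<phi>)\<^sup>2 / (norm (f_push score \<phi>))\<^sup>2)
     else \<infinity>)"

text \<open>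
  The domain of the score differential is the range of the pushforward; \<open>linear_functional_on\<close>
  and \<open>opnorm_on\<close> only look at the values of a function on the subspace \<open>S\<close>.
\<close>

definition linear_functional_on :: "'a::real_vector set \<Rightarrow> ('a \<Rightarrow> real) \<Rightarrow> bool" where
  "linear_functional_on S g \<longleftrightarrow> subspace S \<and>
    (\<forall>x\<in>S. \<forall>y\<in>S. g (x + y) = g x + g y) \<and> (\<forall>c. \<forall>x\<in>S. g (c *\<^sub>R x) = c * g x)"

definition score_differential ::
  "('t \<Rightarrow> real) \<Rightarrow> ('t \<Rightarrow> 'v::semi_inner_space) \<Rightarrow> 'v score_space \<Rightarrow> real" where
  "score_differential d\<beta> score a = (THE r. \<exists>\<phi>. f_push score \<phi> = a \<and> d\<beta> \<phi> = r)"

text \<open>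
  The operator norm of a possibly unbounded functional on \<open>S\<close>; the point \<open>0\<close> contributes
  \<open>0 / 0 = 0\<close>, as in \<^const>\<open>onorm\<close>.
\<close>

definition opnorm_on :: "'a::real_normed_vector set \<Rightarrow> ('a \<Rightarrow> real) \<Rightarrow> ennreal" where
  "opnorm_on S g = (SUP x\<in>S. ennreal (\<bar>g x\<bar> / norm x))"

lemma linear_f_push: "linear score \<Longrightarrow> linear (f_push score)"
  unfolding f_push_def[abs_def]
  using linear_compose[OF linear_compose[OF _ linear_null_coset] linear_to_completion, of score]
  by (simp add: o_def)

lemma norm_f_push: "norm (f_push score \<phi>) = seminorm (score \<phi>)"
  by (simp add: f_push_def norm_to_completion norm_null_coset)

lemma inner_f_push: "f_push score \<phi> \<bullet> f_push score \<psi> = sinner (score \<phi>) (score \<psi>)"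
  by (simp add: f_push_def inner_to_completion inner_null_coset)

lemma score_differential_f_push:
  assumes "linear d\<beta>" "linear score" "\<And>\<phi>. f_push score \<phi> = 0 \<Longrightarrow> d\<beta> \<phi> = 0"
  shows "score_differential d\<beta> score (f_push score \<phi>) = d\<beta> \<phi>"
  unfolding score_differential_def
proof (rule the_equality)
  fix r assume "\<exists>\<psi>. f_push score \<psi> = f_push score \<phi> \<and> d\<beta> \<psi> = r"
  then obtain \<psi> where \<psi>: "f_push score \<psi> = f_push score \<phi>" "d\<beta> \<psi> = r" by blast
  then have "f_push score (\<psi> - \<phi>) = 0"
    by (simp add: linear_diff[OF linear_f_push[OF assms(2)]])
  then have "d\<beta> (\<psi> - \<phi>) = 0" by (rule assms(3))
  with \<psi> show "r = d\<beta> \<phi>" by (simp add: linear_diff[OF assms(1)])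
qed blast

end

theory Submission
  imports Defs
begin

text \<open>
  The Riesz representer of a bounded functional \<open>g\<close> on a subspace \<open>S\<close>, which need not be closed,
  is the limit of a minimizing sequence in \<open>S\<close> of \<open>x \<mapsto> (norm x)\<^sup>2 - 2 * g x\<close>: the sequence is
  Cauchy by the parallelogram law, and the first-order condition at its limit is the
  representation identity. Conversely, Cauchy--Schwarz and density of \<open>S\<close> in its closure make
  the norm of a representer in \<open>closure S\<close> equal to the operator norm.
\<close>

lemma linear_functional_onD:
  assumes "linear_functional_on S g"
  shows "subspace S"
    and "x \<in> S \<Longrightarrow> y \<in> S \<Longrightarrow> g (x + y) = g x + g y"
    and "x \<in> S \<Longrightarrow> g (c *\<^sub>R x) = c * g x"
  using assms by (auto simp: linear_functional_on_def)

lemma riesz_representation_closure: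
  fixes S :: "'a::{real_inner, complete_space} set"
  assumes g: "linear_functional_on S g"
    and bound: "\<And>x. x \<in> S \<Longrightarrow> \<bar>g x\<bar> \<le> K * norm x"
  shows "\<exists>z\<in>closure S. \<forall>x\<in>S. g x = z \<bullet> x"
proof -
  note S = linear_functional_onD(1)[OF g]
  define J where "J x = x \<bullet> x - 2 * g x" for x
  define m where "m = Inf (J ` S)"
  \<comment> \<open>Completing the square: \<open>J x\<close> is at least
    \<open>(norm x)\<^sup>2 - 2 * K * norm x\<close>, which is
    \<open>(norm x - K)\<^sup>2 - K\<^sup>2\<close>. The sign of \<open>K\<close> does not
    matter.\<close>
  have J_lower: "- K\<^sup>2 \<le> J x" if "x \<in> S" for x
  proof -
    have "0 \<le> (norm x - K)\<^sup>2" by simp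
    then show ?thesis
      using bound[OF that] by (simp add: J_def power2_diff power2_norm_eq_inner mult.commute)
  qed
  then have bdd: "bdd_below (J ` S)" by (intro bdd_belowI2)
  have m_le: "m \<le> J x" if "x \<in> S" for x
    unfolding m_def using bdd that by (rule cINF_lower)
  \<comment> \<open>The shift to \<open>Suc n\<close> keeps the slack positive already at
    \<open>n = 0\<close>.\<close>
  have "\<exists>x\<in>S. J x < m + inverse (real (Suc n))" for n
  proof -
    have "J ` S \<noteq> {}" using subspace_0[OF S] by blast
    moreover have "Inf (J ` S) < m + inverse (real (Suc n))" unfolding m_def by simp
    ultimately show ?thesis using bdd by (simp add: cInf_less_iff)
  qed
  then obtain x where x: "\<And>n. x n \<in> S" and Jx: "\<And>n. J (x n) < m + inverse (real (Suc n))"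
    by metis
  \<comment> \<open>In \<open>2 * J a + 2 * J b - 4 * J mid\<close>, with \<open>mid\<close> the
    midpoint of \<open>a\<close> and \<open>b\<close>, the values of \<open>g\<close> cancel by
    linearity and the parallelogram law leaves the squared distance. As \<open>mid\<close> stays in
    \<open>S\<close>, its \<open>J\<close>-value is at least \<open>m\<close>.\<close>
  have near: "(norm (a - b))\<^sup>2 \<le> 2 * (J a - m) + 2 * (J b - m)" if "a \<in> S" "b \<in> S" for a b
  proof -
    have mid: "(1 / 2) *\<^sub>R (a + b) \<in> S" by (intro subspace_scale subspace_add S that)
    have "4 * J ((1 / 2) *\<^sub>R (a + b)) = (a + b) \<bullet> (a + b) - 4 * (g a + g b)"
      using that by (simp add: J_def linear_functional_onD[OF g] subspace_add[OF S] add_divide_distrib)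
    then have "(norm (a - b))\<^sup>2 = 2 * J a + 2 * J b - 4 * J ((1 / 2) *\<^sub>R (a + b))"
      by (simp add: J_def power2_norm_eq_inner inner_add inner_diff inner_commute[of b a])
    with m_le[OF mid] show ?thesis by simp
  qed
  have "Cauchy x"
  proof (rule metric_CauchyI)
    fix e :: real assume "0 < e"
    \<comment> \<open>\<open>near\<close> weights each of the two excesses over \<open>m\<close> by
      2, so excesses below a quarter of \<open>e\<^sup>2\<close> suffice.\<close>
    then have "0 < e\<^sup>2 / 4" by simp
    then obtain N where N: "inverse (real (Suc N)) < e\<^sup>2 / 4"
      using reals_Archimedean by blast
    have J_near: "J (x n) - m < e\<^sup>2 / 4" if "N \<le> n" for n
    proof -
      have "inverse (real (Suc n)) \<le> inverse (real (Suc N))"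
        using that by (simp add: field_simps)
      with Jx[of n] N show ?thesis by linarith
    qed
    have "dist (x i) (x j) < e" if "N \<le> i" "N \<le> j" for i j
    proof -
      note near[OF x[of i] x[of j]]
      also have "2 * (J (x i) - m) + 2 * (J (x j) - m) < 2 * (e\<^sup>2 / 4) + 2 * (e\<^sup>2 / 4)"
        by (intro add_strict_mono mult_strict_left_mono J_near that) simp_all
      also have "\<dots> = e\<^sup>2" by simp
      finally have "(norm (x i - x j))\<^sup>2 < e\<^sup>2" .
      then show ?thesis
        using \<open>0 < e\<close> by (simp add: dist_norm power_less_imp_less_base)
    qed
    then show "\<exists>N. \<forall>i\<ge>N. \<forall>j\<ge>N. dist (x i) (x j) < e" by blast
  qed
  then obtain z where z: "x \<longlonglongrightarrow> z" by (auto simp: Cauchy_convergent_iff convergent_def)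
  have "z \<in> closure S" unfolding closure_sequential using x z by blast
  moreover have "g y = z \<bullet> y" if y: "y \<in> S" for y
  proof -
    define c where "c = z \<bullet> y - g y"
    \<comment> \<open>Perturbing \<open>x n\<close> rather than \<open>z\<close> keeps every
      evaluation of \<open>g\<close> inside \<open>S\<close>, which need not contain
      \<open>z\<close>. The perturbed value is at least \<open>m\<close> and \<open>J (x n)\<close>
      exceeds \<open>m\<close> by less than the slack, which vanishes in the limit.\<close>
    have first_order: "0 \<le> 2 * t * c + t\<^sup>2 * (y \<bullet> y)" for t
    proof (rule tendsto_lowerbound[OF _ always_eventually])
      have "(\<lambda>n. inverse (real (Suc n)) + 2 * t * (x n \<bullet> y - g y) + t\<^sup>2 * (y \<bullet> y))
        \<longlonglongrightarrow> 0 + 2 * t * c + t\<^sup>2 * (y \<bullet> y)"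
        unfolding c_def by (intro tendsto_intros LIMSEQ_inverse_real_of_nat z)
      then show "(\<lambda>n. inverse (real (Suc n)) + 2 * t * (x n \<bullet> y - g y) + t\<^sup>2 * (y \<bullet> y))
        \<longlonglongrightarrow> 2 * t * c + t\<^sup>2 * (y \<bullet> y)"
        by (simp only: add_0)
      show "\<forall>n. 0 \<le> inverse (real (Suc n)) + 2 * t * (x n \<bullet> y - g y) + t\<^sup>2 * (y \<bullet> y)"
      proof
        fix n
        have "J (x n + t *\<^sub>R y) = J (x n) + 2 * t * (x n \<bullet> y - g y) + t\<^sup>2 * (y \<bullet> y)"
          using x y unfolding J_def
          by (simp add: linear_functional_onD[OF g] subspace_scale[OF S] inner_add
              inner_commute[of y "x n"] power2_eq_square algebra_simps)
        moreover have "m \<le> J (x n + t *\<^sub>R y)"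
          by (intro m_le subspace_add subspace_scale S x y)
        ultimately show "0 \<le> inverse (real (Suc n)) + 2 * t * (x n \<bullet> y - g y) + t\<^sup>2 * (y \<bullet> y)"
          using Jx[of n] by linarith
      qed
    qed simp
    \<comment> \<open>With \<open>t = - k * c\<close> the first-order bound becomes
      \<open>c\<^sup>2\<close> times a negative number, which forces \<open>c = 0\<close>. The added
      1 keeps \<open>k\<close> positive when \<open>y = 0\<close>.\<close>
    define k where "k = inverse (y \<bullet> y + 1)"
    have "0 < y \<bullet> y + 1" using inner_ge_zero[of y] by linarith
    then have k: "0 < k" "k * (y \<bullet> y) - 2 < 0"
      by (simp_all add: k_def field_simps)
    have "0 \<le> c\<^sup>2 * (k * (k * (y \<bullet> y) - 2))"
      using first_order[of "- k * c"] by (simp add: power2_eq_square algebra_simps)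
    moreover have "k * (k * (y \<bullet> y) - 2) < 0" using k by (rule mult_pos_neg)
    ultimately have "c\<^sup>2 \<le> 0" using k by (auto simp: zero_le_mult_iff)
    then show ?thesis by (simp add: c_def)
  qed
  ultimately show ?thesis by blast
qed

lemma opnorm_on_inner:
  fixes S :: "'a::real_inner set"
  assumes z: "z \<in> closure S" and g: "\<And>x. x \<in> S \<Longrightarrow> g x = z \<bullet> x"
  shows "opnorm_on S g = ennreal (norm z)"
proof (rule antisym)
  show "opnorm_on S g \<le> ennreal (norm z)"
    unfolding opnorm_on_def
  proof (intro SUP_least ennreal_leI)
    fix x assume "x \<in> S"
    then show "\<bar>g x\<bar> / norm x \<le> norm z"
      using Cauchy_Schwarz_ineq2[of z x]
      by (cases "x = 0") (simp_all add: g divide_le_eq)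
  qed
  show "ennreal (norm z) \<le> opnorm_on S g"
  proof (cases "z = 0")
    case False
    obtain x where x: "\<And>n. x n \<in> S" "x \<longlonglongrightarrow> z"
      using z unfolding closure_sequential by blast
    \<comment> \<open>Cauchy-Schwarz is an equality at \<open>z\<close> itself. Since
      \<open>z\<close> may lie outside \<open>S\<close>, its quotient is only approached, by
      continuity of the quotient at a nonzero point.\<close>
    have "(\<lambda>n. \<bar>z \<bullet> x n\<bar> / norm (x n)) \<longlonglongrightarrow> \<bar>z \<bullet> z\<bar> / norm z"
      using False by (intro tendsto_intros x) simp
    also have "\<bar>z \<bullet> z\<bar> / norm z = norm z"
      using False by (simp add: dot_square_norm power2_eq_square)
    finally have "(\<lambda>n. ennreal (\<bar>g (x n)\<bar> / norm (x n))) \<longlonglongrightarrow> ennreal (norm z)"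
      using x(1) by (intro tendsto_ennrealI) (simp add: g)
    then show ?thesis
      by (rule LIMSEQ_le_const2) (auto simp: opnorm_on_def intro!: SUP_upper x(1))
  qed simp
qed

text \<open>Supplies the real constant \<open>K\<close> that the Riesz construction asks for. At
  \<open>x = 0\<close> the quotient carries no information, and linearity gives
  \<open>g 0 = 0\<close> instead.\<close>

lemma abs_le_opnorm_on:
  assumes g: "linear_functional_on S g" and fin: "opnorm_on S g < \<infinity>" and x: "x \<in> S"
  shows "\<bar>g x\<bar> \<le> enn2real (opnorm_on S g) * norm x"
proof (cases "x = 0")
  case True
  then show ?thesis using linear_functional_onD(3)[OF g x, of 0] by simp
next
  case False
  have "ennreal (\<bar>g x\<bar> / norm x) \<le> opnorm_on S g"
    unfolding opnorm_on_def using x by (rule SUP_upper)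
  also have "\<dots> = ennreal (enn2real (opnorm_on S g))"
    using fin by simp
  finally have "\<bar>g x\<bar> / norm x \<le> enn2real (opnorm_on S g)" by simp
  then show ?thesis using False by (simp add: divide_le_eq)
qed

text \<open>The square of the supremum is a supremum over pairs of indices, and each product
  \<open>f i * f j\<close> is dominated by the square of its larger factor.\<close>

lemma SUP_power2_ennreal: "(SUP i\<in>I. f i)\<^sup>2 = (SUP i\<in>I. (f i)\<^sup>2)" for f :: "'i \<Rightarrow> ennreal"
proof (rule antisym)
  have "f i * f j \<le> (SUP i\<in>I. (f i)\<^sup>2)" if "i \<in> I" "j \<in> I" for i j
  proof -
    have "f i * f j \<le> (f i)\<^sup>2 \<or> f i * f j \<le> (f j)\<^sup>2"
      unfolding power2_eq_square by (metis linear mult_left_mono mult_right_mono zero_le)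
    then show ?thesis using that by (meson SUP_upper2)
  qed
  then show "(SUP i\<in>I. f i)\<^sup>2 \<le> (SUP i\<in>I. (f i)\<^sup>2)"
    unfolding power2_eq_square SUP_mult_left_ennreal SUP_mult_right_ennreal
    by (intro SUP_least)
  show "(SUP i\<in>I. (f i)\<^sup>2) \<le> (SUP i\<in>I. f i)\<^sup>2"
    by (intro SUP_least power_mono SUP_upper) auto
qed

lemma linear_functional_on_score_differential:
  assumes "linear d\<beta>" "linear score" "\<And>\<phi>. f_push score \<phi> = 0 \<Longrightarrow> d\<beta> \<phi> = 0"
  shows "linear_functional_on (range (f_push score)) (score_differential d\<beta> score)"
proof -
  note push = linear_f_push[OF assms(2)]
  note eq = score_differential_f_push[OF assms]
  have "score_differential d\<beta> score (f_push score \<phi> + f_push score \<psi>) = d\<beta> \<phi> + d\<beta> \<psi>" for \<phi> \<psi>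
    using eq[of "\<phi> + \<psi>"] by (simp add: linear_add[OF push] linear_add[OF assms(1)])
  moreover have "score_differential d\<beta> score (c *\<^sub>R f_push score \<phi>) = c * d\<beta> \<phi>" for c \<phi>
    using eq[of "c *\<^sub>R \<phi>"] by (simp add: linear_scale[OF push] linear_scale[OF assms(1)])
  ultimately show ?thesis
    unfolding linear_functional_on_def
    by (auto simp: eq linear_subspace_image[OF push subspace_UNIV])
qed

text \<open>Squaring passes inside the supremum and turns the quotients of the operator norm into
  those of the bound. What remains is to discard the directions with zero pushforward.\<close>

lemma Bnd_eq_opnorm_on_power2:
  assumes "linear d\<beta>" "linear score" "\<And>\<phi>. f_push score \<phi> = 0 \<Longrightarrow> d\<beta> \<phi> = 0"
  shows "Bnd d\<beta> score = (opnorm_on (range (f_push score)) (score_differential d\<beta> score))\<^sup>2"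
proof -
  let ?r = "\<lambda>\<phi>. ennreal ((d\<beta> \<phi>)\<^sup>2 / (norm (f_push score \<phi>))\<^sup>2)"
  have "(opnorm_on (range (f_push score)) (score_differential d\<beta> score))\<^sup>2 = (SUP \<phi>. ?r \<phi>)"
    unfolding opnorm_on_def image_image
    by (simp add: score_differential_f_push[OF assms] SUP_power2_ennreal ennreal_power
        power_divide)
  also have "\<dots> = (SUP \<phi>\<in>{\<phi>. f_push score \<phi> \<noteq> 0}. ?r \<phi>)"
  proof (rule antisym)
    show "(SUP \<phi>. ?r \<phi>) \<le> (SUP \<phi>\<in>{\<phi>. f_push score \<phi> \<noteq> 0}. ?r \<phi>)"
    proof (rule SUP_least)
      fix \<phi>
      show "?r \<phi> \<le> (SUP \<phi>\<in>{\<phi>. f_push score \<phi> \<noteq> 0}. ?r \<phi>)"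
        \<comment> \<open>A zero pushforward contributes 0, as division by zero yields 0. This is
          harmless even when the right-hand supremum is over the empty set.\<close>
        by (cases "f_push score \<phi> = 0") (simp, intro SUP_upper, simp)
    qed
  qed (rule SUP_subset_mono, simp_all)
  also have "\<dots> = Bnd d\<beta> score"
    using assms(3) by (simp add: Bnd_def)
  finally show ?thesis by simp
qed

theorem mainTheorem1:
  fixes d\<beta> :: "'t::real_vector \<Rightarrow> real"
    and score :: "'t \<Rightarrow> 'v::semi_inner_space"
    and \<Delta>\<beta> :: "'v score_space \<Rightarrow> real"
  assumes "linear d\<beta>"
    and "linear score"
    and "\<forall>\<phi>. f_push score \<phi> = 0 \<longrightarrow> d\<beta> \<phi> = 0"
    and "\<Delta>\<beta> = score_differential d\<beta> score"
  shows "linear_functional_on (range (f_push score)) \<Delta>\<beta> \<and>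
    (\<forall>\<phi>. \<Delta>\<beta> (f_push score \<phi>) = d\<beta> \<phi>) \<and>
    Bnd d\<beta> score = (opnorm_on (range (f_push score)) \<Delta>\<beta>)\<^sup>2 \<and>
    ((opnorm_on (range (f_push score)) \<Delta>\<beta>)\<^sup>2 < \<infinity> \<longleftrightarrow>
      (\<exists>g\<in>score_tangent_space score.
        \<forall>\<phi>. d\<beta> \<phi> = \<Delta>\<beta> (f_push score \<phi>) \<and> \<Delta>\<beta> (f_push score \<phi>) = g \<bullet> f_push score \<phi>)) \<and>
    (\<forall>g\<in>score_tangent_space score.
      (\<forall>\<phi>. d\<beta> \<phi> = \<Delta>\<beta> (f_push score \<phi>) \<and> \<Delta>\<beta> (f_push score \<phi>) = g \<bullet> f_push score \<phi>) \<longrightarrow>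
      Bnd d\<beta> score = ennreal ((norm g)\<^sup>2))"
proof -
  let ?S = "range (f_push score)"
  have null: "\<And>\<phi>. f_push score \<phi> = 0 \<Longrightarrow> d\<beta> \<phi> = 0" using assms(3) by blast
  have lin: "linear_functional_on ?S \<Delta>\<beta>"
    unfolding assms(4) using assms(1,2) null by (rule linear_functional_on_score_differential)
  have eq: "\<Delta>\<beta> (f_push score \<phi>) = d\<beta> \<phi>" for \<phi>
    unfolding assms(4) using assms(1,2) null by (rule score_differential_f_push)
  have Bnd: "Bnd d\<beta> score = (opnorm_on ?S \<Delta>\<beta>)\<^sup>2"
    unfolding assms(4) using assms(1,2) null by (rule Bnd_eq_opnorm_on_power2)
  \<comment> \<open>Used twice: for finiteness once a representer exists, and for the value of the
    bound.\<close>
  have norm_eq: "(opnorm_on ?S \<Delta>\<beta>)\<^sup>2 = ennreal ((norm g)\<^sup>2)"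
    if "g \<in> score_tangent_space score" "\<And>\<phi>. \<Delta>\<beta> (f_push score \<phi>) = g \<bullet> f_push score \<phi>" for g
  proof -
    have "opnorm_on ?S \<Delta>\<beta> = ennreal (norm g)"
      using that unfolding score_tangent_space_def by (intro opnorm_on_inner) auto
    then show ?thesis by (simp add: ennreal_power)
  qed
  have riesz: "\<exists>g\<in>score_tangent_space score. \<forall>\<phi>. \<Delta>\<beta> (f_push score \<phi>) = g \<bullet> f_push score \<phi>"
    if "(opnorm_on ?S \<Delta>\<beta>)\<^sup>2 < \<infinity>"
  proof -
    have "opnorm_on ?S \<Delta>\<beta> < \<infinity>"
      using that by (cases "opnorm_on ?S \<Delta>\<beta> = \<infinity>") (auto simp: less_top)
    from riesz_representation_closure[OF lin abs_le_opnorm_on[OF lin this]]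
    show ?thesis unfolding score_tangent_space_def by blast
  qed
  show ?thesis
  proof (intro conjI iffI allI ballI impI)
    assume "(opnorm_on ?S \<Delta>\<beta>)\<^sup>2 < \<infinity>"
    with riesz show "\<exists>g\<in>score_tangent_space score.
        \<forall>\<phi>. d\<beta> \<phi> = \<Delta>\<beta> (f_push score \<phi>) \<and> \<Delta>\<beta> (f_push score \<phi>) = g \<bullet> f_push score \<phi>"
      by (simp add: eq)
  next
    assume "\<exists>g\<in>score_tangent_space score.
        \<forall>\<phi>. d\<beta> \<phi> = \<Delta>\<beta> (f_push score \<phi>) \<and> \<Delta>\<beta> (f_push score \<phi>) = g \<bullet> f_push score \<phi>"
    then obtain g where "g \<in> score_tangent_space score"
      "\<And>\<phi>. \<Delta>\<beta> (f_push score \<phi>) = g \<bullet> f_push score \<phi>" by blast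
    from norm_eq[OF this] show "(opnorm_on ?S \<Delta>\<beta>)\<^sup>2 < \<infinity>" by simp
  next
    fix g assume "g \<in> score_tangent_space score"
      "\<forall>\<phi>. d\<beta> \<phi> = \<Delta>\<beta> (f_push score \<phi>) \<and> \<Delta>\<beta> (f_push score \<phi>) = g \<bullet> f_push score \<phi>"
    then show "Bnd d\<beta> score = ennreal ((norm g)\<^sup>2)"
      unfolding Bnd by (intro norm_eq) auto
  qed (use lin eq Bnd in auto)
qed

end
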